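(* Let $\Bbbk$ be an algebraically closed field of characteristic zero, $q\in\Bbbk$ nonzero and not a root of unity, $R=\Bbbk\langle x,y:yx=qxy+1\rangle$, $\mu\in\Bbbk^*$, and $\sigma$ the automorphism of $R$ with $\sigma(x)=\mu^{-1}x$, $\sigma(y)=\mu y$. Let $w=\sum_{i}\sum_j c_{(i,j)}x^iy^j\in R$ and $S=\{j-i\in\mathbb Z: c_{(i,j)}\ne0\}$, and let $\delta=\mathrm{ad}_w$ be the inner $\sigma$-derivation $\delta(a)=wa-\sigma(a)w$ of $R$. Let $\rho\neq\mathrm{id}$ be an automorphism of $R$, given by $\rho(x)=\beta^{-1}x$, $\rho(y)=\beta y$ with $\beta\in\Bbbk^*$. Then $\delta\rho=\rho\delta$ if and only if $\beta^{c}=1$, where $c=\gcd S$.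
   Context: All automorphisms are $\Bbbk$-algebra automorphisms. A $\sigma$-derivation of $R$ is a $\Bbbk$-linear map $\delta:R\to R$ with $\delta(ab)=\delta(a)b+\sigma(a)\delta(b)$ for all $a,b\in R$. Since $q$ is not a root of unity, every automorphism $\rho$ of $R$ has the form $\rho(x)=\beta^{-1}x$, $\rho(y)=\beta y$ for some $\beta\in\Bbbk^*$ (known fact). The monomials $x^iy^j$ ($i,j\ge0$) form a basis of $R$. Convention: the gcd of $\{0\}$ and of the empty set is $0$, and $\beta^0=1$. *)

theory Defs
  imports
    "HOL-Algebra.Algebra"
    "HOL-Algebra.Algebraic_Closure_Type"
    "HOL-Library.Poly_Mapping"
begin

text \<open>
  The free algebra on \<open>x, y\<close> over \<open>'k\<close> is the monoid algebra of the free monoid on two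
  letters: finitely supported functions on words, with the convolution product that
  \<^theory>\<open>HOL-Library.Poly_Mapping\<close> provides over any (not necessarily commutative) monoid written
  additively. A separate type of words is used because lists carry no such monoid instance.
\<close>

datatype gen = GX | GY

datatype word = Word (letters: "gen list")

instantiation word :: monoid_add
begin

definition zero_word :: word where "zero_word = Word []"

definition plus_word :: "word \<Rightarrow> word \<Rightarrow> word"
  where "plus_word u v = Word (letters u @ letters v)"

instance
  by intro_classes (simp_all add: zero_word_def plus_word_def)

end

type_synonym 'k free_alg = "word \<Rightarrow>\<^sub>0 'k"

definition gen_alg :: "gen \<Rightarrow> 'k::field free_alg"
  where "gen_alg g = Poly_Mapping.single (Word [g]) 1"

definition const_alg :: "'k::field \<Rightarrow> 'k free_alg"
  where "const_alg a = Poly_Mapping.single 0 a"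

definition free_algebra :: "'k::field free_alg ring"
  where "free_algebra = ring_of_type_algebra"

definition qweyl_rel :: "'k::field \<Rightarrow> 'k free_alg"
  where "qweyl_rel q = gen_alg GY * gen_alg GX - (const_alg q * gen_alg GX * gen_alg GY + 1)"

definition qweyl_ideal :: "'k::field \<Rightarrow> 'k free_alg set"
  where "qweyl_ideal q = Idl\<^bsub>free_algebra\<^esub> {qweyl_rel q}"

definition qweyl :: "'k::field \<Rightarrow> 'k free_alg set ring"
  where "qweyl q = free_algebra Quot qweyl_ideal q"

definition qweyl_class :: "'k::field \<Rightarrow> 'k free_alg \<Rightarrow> 'k free_alg set"
  where "qweyl_class q f = qweyl_ideal q +>\<^bsub>free_algebra\<^esub> f"

definition qx :: "'k::field \<Rightarrow> 'k free_alg set"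
  where "qx q = qweyl_class q (gen_alg GX)"

definition qy :: "'k::field \<Rightarrow> 'k free_alg set"
  where "qy q = qweyl_class q (gen_alg GY)"

text \<open>Scalar multiplication is multiplication by the (central) image of the scalar.\<close>

definition qsmult :: "'k::field \<Rightarrow> 'k \<Rightarrow> 'k free_alg set \<Rightarrow> 'k free_alg set"
  where "qsmult q a r = qweyl_class q (const_alg a) \<otimes>\<^bsub>qweyl q\<^esub> r"

definition qweyl_elem :: "'k::field \<Rightarrow> (nat \<times> nat \<Rightarrow>\<^sub>0 'k) \<Rightarrow> 'k free_alg set"
  where "qweyl_elem q c =
    (\<Oplus>\<^bsub>qweyl q\<^esub>p\<in>Poly_Mapping.keys c. qsmult q (Poly_Mapping.lookup c p)
       (qx q [^]\<^bsub>qweyl q\<^esub> fst p \<otimes>\<^bsub>qweyl q\<^esub> qy q [^]\<^bsub>qweyl q\<^esub> snd p))"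

definition qweyl_automorphism ::
  "'k::field \<Rightarrow> ('k free_alg set \<Rightarrow> 'k free_alg set) \<Rightarrow> bool"
  where "qweyl_automorphism q \<phi> \<longleftrightarrow>
    \<phi> \<in> ring_iso (qweyl q) (qweyl q) \<and>
    (\<forall>a. \<forall>r\<in>carrier (qweyl q). \<phi> (qsmult q a r) = qsmult q a (\<phi> r))"

definition sigma_derivation ::
  "'k::field \<Rightarrow> ('k free_alg set \<Rightarrow> 'k free_alg set) \<Rightarrow> ('k free_alg set \<Rightarrow> 'k free_alg set) \<Rightarrow> bool"
  where "sigma_derivation q \<sigma> \<delta> \<longleftrightarrow>
    \<delta> \<in> carrier (qweyl q) \<rightarrow> carrier (qweyl q) \<and>
    (\<forall>r\<in>carrier (qweyl q). \<forall>s\<in>carrier (qweyl q). \<delta> (r \<oplus>\<^bsub>qweyl q\<^esub> s) = \<delta> r \<oplus>\<^bsub>qweyl q\<^esub> \<delta> s) \<and>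
    (\<forall>a. \<forall>r\<in>carrier (qweyl q). \<delta> (qsmult q a r) = qsmult q a (\<delta> r)) \<and>
    (\<forall>r\<in>carrier (qweyl q). \<forall>s\<in>carrier (qweyl q).
       \<delta> (r \<otimes>\<^bsub>qweyl q\<^esub> s) = \<delta> r \<otimes>\<^bsub>qweyl q\<^esub> s \<oplus>\<^bsub>qweyl q\<^esub> \<sigma> r \<otimes>\<^bsub>qweyl q\<^esub> \<delta> s)"

definition inner_sderiv ::
  "'k::field \<Rightarrow> ('k free_alg set \<Rightarrow> 'k free_alg set) \<Rightarrow> 'k free_alg set
    \<Rightarrow> 'k free_alg set \<Rightarrow> 'k free_alg set"
  where "inner_sderiv q \<sigma> w a =
    w \<otimes>\<^bsub>qweyl q\<^esub> a \<ominus>\<^bsub>qweyl q\<^esub> \<sigma> a \<otimes>\<^bsub>qweyl q\<^esub> w"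

lemma ring_free_algebra: "ring (free_algebra :: 'k::field free_alg ring)"
proof -
  have "\<exists>y. x + y = 0" for x :: "'k free_alg"
    using add.right_inverse by blast
  moreover have "\<exists>y. y + x = 0" for x :: "'k free_alg"
    using add.left_inverse by blast
  ultimately show ?thesis
    unfolding free_algebra_def ring_of_type_algebra_def
    by unfold_locales (auto simp: algebra_simps Units_def)
qed

lemma carrier_free_algebra [simp]: "carrier free_algebra = UNIV"
  and mult_free_algebra [simp]: "f \<otimes>\<^bsub>free_algebra\<^esub> g = f * g"
  and add_free_algebra [simp]: "f \<oplus>\<^bsub>free_algebra\<^esub> g = f + g"
  and one_free_algebra [simp]: "\<one>\<^bsub>free_algebra\<^esub> = 1"
  and zero_free_algebra [simp]: "\<zero>\<^bsub>free_algebra\<^esub> = 0"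
  by (simp_all add: free_algebra_def ring_of_type_algebra_def)

lemma ideal_qweyl_ideal: "ideal (qweyl_ideal q) free_algebra"
  unfolding qweyl_ideal_def
  by (rule ring.genideal_ideal[OF ring_free_algebra]) simp

lemma ring_qweyl: "ring (qweyl q)"
  unfolding qweyl_def by (rule ideal.quotient_is_ring[OF ideal_qweyl_ideal])

lemma qweyl_class_hom: "qweyl_class q \<in> ring_hom free_algebra (qweyl q)"
  unfolding qweyl_def qweyl_class_def[abs_def]
  by (rule ideal.rcos_ring_hom[OF ideal_qweyl_ideal])

lemma qweyl_class_closed [simp]: "qweyl_class q f \<in> carrier (qweyl q)"
  using ring_hom_closed[OF qweyl_class_hom] by simp

lemma qweyl_class_mult:
  "qweyl_class q (f * g) = qweyl_class q f \<otimes>\<^bsub>qweyl q\<^esub> qweyl_class q g"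
  using ring_hom_mult[OF qweyl_class_hom, of f g] by simp

lemma qweyl_class_add:
  "qweyl_class q (f + g) = qweyl_class q f \<oplus>\<^bsub>qweyl q\<^esub> qweyl_class q g"
  using ring_hom_add[OF qweyl_class_hom, of f g] by simp

lemma qweyl_class_one: "qweyl_class q 1 = \<one>\<^bsub>qweyl q\<^esub>"
  using ring_hom_one[OF qweyl_class_hom] by simp

lemma carrier_qweyl: "carrier (qweyl q) = range (qweyl_class q)"
  by (auto simp: qweyl_def FactRing_def A_RCOSETS_def' qweyl_class_def)

lemma qweyl_relation:
  "qy q \<otimes>\<^bsub>qweyl q\<^esub> qx q =
     qsmult q q (qx q \<otimes>\<^bsub>qweyl q\<^esub> qy q) \<oplus>\<^bsub>qweyl q\<^esub> \<one>\<^bsub>qweyl q\<^esub>"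
proof -
  interpret I: ideal "qweyl_ideal q" free_algebra by (rule ideal_qweyl_ideal)
  let ?f = "const_alg q * gen_alg GX * gen_alg GY + 1"
  have "qweyl_rel q \<in> qweyl_ideal q"
    unfolding qweyl_ideal_def using I.genideal_self[of "{qweyl_rel q}"] by simp
  then have "qweyl_class q (qweyl_rel q) = \<zero>\<^bsub>qweyl q\<^esub>"
    using I.a_rcos_const by (simp add: qweyl_class_def qweyl_def FactRing_def)
  moreover have "gen_alg GY * gen_alg GX = qweyl_rel q + ?f"
    by (simp add: qweyl_rel_def)
  ultimately have "qweyl_class q (gen_alg GY * gen_alg GX) = qweyl_class q ?f"
    using ring.ring_simprules(8)[OF ring_qweyl qweyl_class_closed]
    by (simp only: qweyl_class_add[of _ "qweyl_rel q"])
  then show ?thesis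
    by (simp add: qx_def qy_def qsmult_def qweyl_class_mult qweyl_class_add qweyl_class_one
        monoid.m_assoc[OF ring.is_monoid[OF ring_qweyl]])
qed

lemma const_alg_central: "const_alg a * f = f * const_alg a"
proof (induction f rule: update_induct)
  case const
  then show ?case by simp
next
  case (update f k v)
  have "Poly_Mapping.update k v f = f + Poly_Mapping.single k v"
    using update.hyps(1)
    by (intro poly_mapping_eqI) (auto simp: lookup_update lookup_add lookup_single in_keys_iff when_def)
  moreover have "const_alg a * Poly_Mapping.single k v = Poly_Mapping.single k v * const_alg a"
    by (simp add: const_alg_def mult_single mult.commute)
  ultimately show ?case using update.IH by (simp add: distrib_left distrib_right)
qed

lemma sigma_derivation_inner_sderiv:
  assumes "qweyl_automorphism q \<sigma>" and w: "w \<in> carrier (qweyl q)"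
  shows "sigma_derivation q \<sigma> (inner_sderiv q \<sigma> w)"
proof -
  interpret R: ring "qweyl q" by (rule ring_qweyl)
  have hom: "\<sigma> \<in> ring_hom (qweyl q) (qweyl q)"
    and lin: "\<And>a r. r \<in> carrier (qweyl q) \<Longrightarrow> \<sigma> (qsmult q a r) = qsmult q a (\<sigma> r)"
    using assms by (auto simp: qweyl_automorphism_def ring_iso_def)
  note cl = ring_hom_closed[OF hom] w
  have smult_closed: "qsmult q a r \<in> carrier (qweyl q)" if "r \<in> carrier (qweyl q)" for a r
    using that by (simp add: qsmult_def)
  have central: "w \<otimes>\<^bsub>qweyl q\<^esub> qweyl_class q (const_alg a) =
      qweyl_class q (const_alg a) \<otimes>\<^bsub>qweyl q\<^esub> w" for a
    using w by (auto simp: carrier_qweyl qweyl_class_mult[symmetric] const_alg_central)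
  have "inner_sderiv q \<sigma> w (qsmult q a r) = qsmult q a (inner_sderiv q \<sigma> w r)"
    if r: "r \<in> carrier (qweyl q)" for a r
  proof -
    have "w \<otimes>\<^bsub>qweyl q\<^esub> qsmult q a r = qsmult q a (w \<otimes>\<^bsub>qweyl q\<^esub> r)"
      using r w by (simp add: qsmult_def R.m_assoc[symmetric] central)
    moreover have "\<sigma> (qsmult q a r) \<otimes>\<^bsub>qweyl q\<^esub> w = qsmult q a (\<sigma> r \<otimes>\<^bsub>qweyl q\<^esub> w)"
      using r cl by (simp add: lin) (simp add: qsmult_def R.m_assoc)
    ultimately show ?thesis
      using r cl by (simp add: inner_sderiv_def qsmult_def R.r_minus R.r_distr a_minus_def)
  qed
  moreover have "inner_sderiv q \<sigma> w (r \<oplus>\<^bsub>qweyl q\<^esub> s) =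
      inner_sderiv q \<sigma> w r \<oplus>\<^bsub>qweyl q\<^esub> inner_sderiv q \<sigma> w s"
    if "r \<in> carrier (qweyl q)" "s \<in> carrier (qweyl q)" for r s
    using that cl ring_hom_add[OF hom]
    by (simp add: inner_sderiv_def a_minus_def R.l_distr R.r_distr R.minus_add R.a_ac)
  moreover have "inner_sderiv q \<sigma> w (r \<otimes>\<^bsub>qweyl q\<^esub> s) =
      inner_sderiv q \<sigma> w r \<otimes>\<^bsub>qweyl q\<^esub> s \<oplus>\<^bsub>qweyl q\<^esub>
      \<sigma> r \<otimes>\<^bsub>qweyl q\<^esub> inner_sderiv q \<sigma> w s"
    if "r \<in> carrier (qweyl q)" "s \<in> carrier (qweyl q)" for r s
    using that cl ring_hom_mult[OF hom]
    by (simp add: inner_sderiv_def a_minus_def R.l_distr R.r_distr R.l_minus R.r_minus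
        R.m_assoc R.a_assoc R.r_neg1)
  ultimately show ?thesis
    using cl by (auto simp: sigma_derivation_def inner_sderiv_def)
qed

end

theory Submission
  imports Defs
begin

text \<open>
  The element \<open>t = y x\<close> is fixed by \<open>\<sigma>\<close> and \<open>\<rho>\<close>, so if \<open>\<delta>\<close> and \<open>\<rho>\<close> commute then evaluating both
  composites at \<open>t\<close> shows that \<open>u = w - \<rho> w\<close> commutes with \<open>t\<close>. Let \<open>R\<close> act on sequences \<open>v\<close> with
  \<open>x\<close> as the right shift and \<open>y\<close> as \<open>(y v) n = [n + 1] v (n + 1)\<close>, where \<open>[n] = 1 + q + \<dots> + q ^ (n - 1)\<close>.
  There \<open>t\<close> is diagonal with eigenvalues \<open>[n + 1]\<close>, pairwise distinct because \<open>q\<close> is not a root of unity.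
  Hence \<open>u\<close> acts diagonally, and triangularity of the action of the monomials forces the coefficients
  \<open>c\<^sub>i\<^sub>j (1 - \<beta> powi (j - i))\<close> of \<open>u\<close> with \<open>i \<noteq> j\<close> to vanish; those with \<open>i = j\<close> vanish anyway.
  Conversely, if \<open>\<beta> powi s = 1\<close> for all \<open>s \<in> S\<close> then \<open>\<rho> w = w\<close>, and \<open>\<rho>\<close> and \<open>\<sigma>\<close> commute since
  both act diagonally on words.
\<close>

subsection \<open>The action on sequences\<close>

definition qnum :: "'k::field \<Rightarrow> nat \<Rightarrow> 'k"
  where "qnum q n = (\<Sum>k<n. q ^ k)"

lemma qnum_Suc: "qnum q (Suc n) = q * qnum q n + 1"
  unfolding qnum_def by (subst sum.lessThan_Suc_shift) (simp add: sum_distrib_left)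

lemma qnum_geometric: "(q - 1) * qnum q n = q ^ n - 1"
  by (simp add: qnum_def power_diff_1_eq)

text \<open>Multiplying by \<open>q - 1\<close> turns \<open>qnum q m = qnum q n\<close> into
  \<open>q ^ m = q ^ n\<close>; cancelling the smaller power would make \<open>q\<close> a root of
  unity.\<close>

lemma qnum_inject:
  fixes q :: "'k::field"
  assumes "q \<noteq> 0" and root: "\<And>n::nat. n > 0 \<Longrightarrow> q ^ n \<noteq> 1"
    and eq: "qnum q m = qnum q n"
  shows "m = n"
proof -
  have "\<not> k < l" if "qnum q k = qnum q l" for k l
  proof
    assume "k < l"
    have "q ^ k = q ^ l"
      using that qnum_geometric[of q k] qnum_geometric[of q l] by simp
    also have "q ^ l = q ^ k * q ^ (l - k)"
      using \<open>k < l\<close> by (simp flip: power_add)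
    finally have "q ^ (l - k) = 1"
      using \<open>q \<noteq> 0\<close> by simp
    then show False
      using root[of "l - k"] \<open>k < l\<close> by simp
  qed
  then show ?thesis
    using eq by (metis linorder_neqE_nat)
qed

text \<open>Reading \<open>v\<close> as the coefficients of a power series in \<open>z\<close>,
  \<open>GX\<close> is multiplication by \<open>z\<close> and \<open>GY\<close> is the Jackson
  q-derivative.\<close>

fun act_gen :: "'k::field \<Rightarrow> gen \<Rightarrow> (nat \<Rightarrow> 'k) \<Rightarrow> nat \<Rightarrow> 'k"
  where
    "act_gen q GX v n = (case n of 0 \<Rightarrow> 0 | Suc m \<Rightarrow> v m)"
  | "act_gen q GY v n = qnum q (Suc n) * v (Suc n)"

text \<open>\<open>foldr\<close> lets the last letter act first, so that concatenation becomes
  composition and the action is a left action.\<close>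

definition act_word :: "'k::field \<Rightarrow> word \<Rightarrow> (nat \<Rightarrow> 'k) \<Rightarrow> nat \<Rightarrow> 'k"
  where "act_word q u = foldr (act_gen q) (letters u)"

definition act :: "'k::field \<Rightarrow> 'k free_alg \<Rightarrow> (nat \<Rightarrow> 'k) \<Rightarrow> nat \<Rightarrow> 'k"
  where "act q f v n =
    (\<Sum>u\<in>Poly_Mapping.keys f. Poly_Mapping.lookup f u * act_word q u v n)"

lemma act_word_plus: "act_word q (u + u') v = act_word q u (act_word q u' v)"
  by (simp add: act_word_def plus_word_def)

lemma act_word_add:
  "act_word q u (\<lambda>n. v n + v' n) = (\<lambda>n. act_word q u v n + act_word q u v' n)"
proof -
  have gen: "act_gen q g (\<lambda>n. v n + v' n) = (\<lambda>n. act_gen q g v n + act_gen q g v' n)" for g v v'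
    by (cases g) (auto simp: fun_eq_iff algebra_simps split: nat.splits)
  have "foldr (act_gen q) gs (\<lambda>n. v n + v' n) =
      (\<lambda>n. foldr (act_gen q) gs v n + foldr (act_gen q) gs v' n)" for gs
    by (induction gs) (simp_all add: gen)
  then show ?thesis
    by (simp add: act_word_def)
qed

lemma act_word_scale: "act_word q u (\<lambda>n. a * v n) = (\<lambda>n. a * act_word q u v n)"
proof -
  have gen: "act_gen q g (\<lambda>n. a * v n) = (\<lambda>n. a * act_gen q g v n)" for g v
    by (cases g) (auto simp: fun_eq_iff split: nat.splits)
  have "foldr (act_gen q) gs (\<lambda>n. a * v n) = (\<lambda>n. a * foldr (act_gen q) gs v n)" for gs
    by (induction gs) (simp_all add: gen)
  then show ?thesis
    by (simp add: act_word_def)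
qed

text \<open>Allows elements with different supports to be summed over one common index set.\<close>

lemma act_superset:
  assumes "finite A" "Poly_Mapping.keys f \<subseteq> A"
  shows "act q f v n = (\<Sum>u\<in>A. Poly_Mapping.lookup f u * act_word q u v n)"
  unfolding act_def using assms
  by (intro sum.mono_neutral_left) (auto simp: in_keys_iff)

lemma act_add: "act q (f + g) v n = act q f v n + act q g v n"
proof -
  let ?A = "Poly_Mapping.keys f \<union> Poly_Mapping.keys g"
  have "Poly_Mapping.keys (f + g) \<subseteq> ?A"
    by (rule Poly_Mapping.keys_add)
  then show ?thesis
    by (simp add: act_superset[of ?A] lookup_add algebra_simps sum.distrib)
qed

lemma act_zero [simp]: "act q 0 v n = 0"
  by (simp add: act_def)

lemma act_uminus: "act q (- f) v n = - act q f v n"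
  using act_add[of q f "- f" v n] by (simp add: eq_neg_iff_add_eq_0 add.commute)

lemma act_diff: "act q (f - g) v n = act q f v n - act q g v n"
  using act_add[of q "f - g" g v n] by simp

lemma act_single [simp]: "act q (Poly_Mapping.single u a) v n = a * act_word q u v n"
  by (simp add: act_def)

lemma act_zero_vector [simp]: "act q f (\<lambda>_. 0) n = 0"
  using act_word_scale[of q _ 0 "\<lambda>_. 0"] by (simp add: act_def fun_eq_iff)

lemma act_sum: "act q (\<Sum>p\<in>A. f p) v n = (\<Sum>p\<in>A. act q (f p) v n)"
  by (induction A rule: infinite_finite_induct) (simp_all add: act_add)

text \<open>Updating at a fresh key is adding a \<open>single\<close>, so additive properties reduce
  to scaled words.\<close>

lemma free_alg_induct [case_names single add]:
  fixes f :: "'k::field free_alg"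
  assumes single: "\<And>u a. P (Poly_Mapping.single u a)"
    and add: "\<And>f g. P f \<Longrightarrow> P g \<Longrightarrow> P (f + g)"
  shows "P f"
proof (induction f rule: update_induct)
  case const
  then show ?case using single[of 0 0] by simp
next
  case (update f k v)
  have "Poly_Mapping.update k v f = f + Poly_Mapping.single k v"
    using update.hyps(1)
    by (intro poly_mapping_eqI) (auto simp: lookup_update lookup_add lookup_single in_keys_iff when_def)
  then show ?case using update.IH add single by simp
qed

text \<open>Both sides are biadditive in \<open>f\<close> and \<open>g\<close>. For two scaled
  words, multiplication is concatenation, which acts as composition.\<close>

lemma act_mult: "act q (f * g) v = act q f (act q g v)"
proof (induction f rule: free_alg_induct)
  case (single u a)
  show ?case
  proof (induction g rule: free_alg_induct)
    case (single u' b)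
    have "act q (Poly_Mapping.single u' b) v = (\<lambda>n. b * act_word q u' v n)"
      by (simp add: fun_eq_iff)
    then show ?case
      by (simp add: fun_eq_iff mult_single act_word_plus act_word_scale mult.assoc)
  next
    case (add g h)
    have "act q (g + h) v = (\<lambda>n. act q g v n + act q h v n)"
      by (simp add: fun_eq_iff act_add)
    then show ?case
      using add by (simp add: fun_eq_iff distrib_left act_add act_word_add)
  qed
next
  case (add f g)
  then show ?case
    by (simp add: fun_eq_iff distrib_right act_add)
qed

lemma act_gen_alg: "act q (gen_alg g) v = act_gen q g v"
  by (simp add: fun_eq_iff gen_alg_def act_word_def)

lemma act_const_alg: "act q (const_alg a) v n = a * v n"
  by (simp add: const_alg_def act_word_def zero_word_def)

lemma act_yx: "act q (gen_alg GY * gen_alg GX) v n = qnum q (Suc n) * v n"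
  by (simp add: act_mult act_gen_alg)

section \<open>Compatibility of the action with the defining relation\<close>

lemma act_qweyl_rel: "act q (qweyl_rel q) v n = 0"
proof -
  have one: "act q 1 v n = v n" for n
    using act_const_alg[of q 1 v n] by (simp only: const_alg_def single_one mult_1)
  \<comment> \<open>At index 0 the product \<open>x y\<close> contributes nothing and
    \<open>qnum q 1 = 1\<close> remains; at a successor the claim is the recursion
    \<open>qnum_Suc\<close>.\<close>
  show ?thesis
    by (cases n)
      (simp_all add: qweyl_rel_def act_diff act_add act_mult act_gen_alg act_const_alg one qnum_Suc
        algebra_simps, simp_all add: qnum_def)
qed

text \<open>The annihilator of the sequence space is a two-sided ideal containing
  \<open>qweyl_rel q\<close>, hence contains the ideal generated by it.\<close>

lemma act_qweyl_ideal:
  assumes "f \<in> qweyl_ideal q"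
  shows "act q f v n = 0"
proof -
  let ?K = "{f. \<forall>v n. act q f v n = 0}"
  interpret ring "free_algebra :: 'a free_alg ring" by (rule ring_free_algebra)
  have inv: "\<ominus>\<^bsub>free_algebra\<^esub> g = - g" for g :: "'a free_alg"
    by (rule minus_equality) simp_all
  have ker: "act q g v = (\<lambda>_. 0)" if "g \<in> ?K" for g v
    using that by auto
  have "ideal ?K free_algebra"
  proof (intro idealI ring_free_algebra)
    show "subgroup ?K (add_monoid free_algebra)"
      by (rule group.subgroupI[OF a_group])
        (use inv in \<open>auto simp: act_add act_uminus a_inv_def intro: exI[of _ 0]\<close>)
  next
    fix a x :: "'a free_alg"
    assume x: "a \<in> ?K"
    show "x \<otimes>\<^bsub>free_algebra\<^esub> a \<in> ?K"
      by (simp add: act_mult ker[OF x])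
    show "a \<otimes>\<^bsub>free_algebra\<^esub> x \<in> ?K"
      by (simp add: act_mult ker[OF x])
  qed
  then have "qweyl_ideal q \<subseteq> ?K"
    unfolding qweyl_ideal_def by (rule genideal_minimal) (simp add: act_qweyl_rel)
  then show ?thesis
    using assms by blast
qed

text \<open>The action is never defined on cosets; this is how an equation in the quotient becomes
  an equation between operators.\<close>

lemma act_eq_if_class_eq:
  assumes "qweyl_class q f = qweyl_class q g"
  shows "act q f = act q g"
proof -
  interpret I: ideal "qweyl_ideal q" free_algebra by (rule ideal_qweyl_ideal)
  have "f \<in> qweyl_class q g"
    using I.a_rcos_self[of f] assms by (simp add: qweyl_class_def)
  then obtain h where "h \<in> qweyl_ideal q" "f = h + g"
    by (auto simp: qweyl_class_def a_r_coset_def')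
  then show ?thesis
    by (simp add: fun_eq_iff act_add act_qweyl_ideal)
qed

section \<open>Monomials and operators commuting with \<open>y x\<close>\<close>

definition mono_word :: "nat \<times> nat \<Rightarrow> word"
  where "mono_word p = Word (replicate (fst p) GX @ replicate (snd p) GY)"

text \<open>The letters \<open>GY\<close> act first, lowering the degree by \<open>j\<close> and
  collecting the q-numbers; the letters \<open>GX\<close> then raise it by \<open>i\<close>. The
  guard keeps the subtraction on naturals exact.\<close>

lemma act_mono_word:
  "act_word q (mono_word (i, j)) v n =
    (if n < i then 0 else (\<Prod>k<j. qnum q (Suc (n - i + k))) * v (n - i + j))"
proof -
  have Y: "foldr (act_gen q) (replicate j GY) v n = (\<Prod>k<j. qnum q (Suc (n + k))) * v (n + j)" for n
    by (induction j arbitrary: n) (simp_all add: prod.lessThan_Suc_shift del: prod.lessThan_Suc)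
  have X: "foldr (act_gen q) (replicate i GX) v n = (if n < i then 0 else v (n - i))" for v n
    by (induction i arbitrary: n) (simp_all split: nat.split)
  show ?thesis
    by (simp add: act_word_def mono_word_def X Y del: foldr_replicate)
qed

text \<open>
  Reading off the coefficient of the basis vector \<open>m\<close> in the image of the basis vector \<open>n\<close> involves
  only monomials with \<open>i \<le> m\<close> and \<open>i - j = m - n\<close>; taking \<open>(m, n) = (i, j)\<close>, all but one of them are
  covered by the induction hypothesis.
\<close>
lemma off_diagonal_coeff_eq_0:
  fixes q :: "'k::field"
  assumes q: "q \<noteq> 0" "\<And>n::nat. n > 0 \<Longrightarrow> q ^ n \<noteq> 1"
    and fin: "finite A" and supp: "\<And>p. p \<notin> A \<Longrightarrow> u p = 0"
    and D: "D = (\<Sum>p\<in>A. Poly_Mapping.single (mono_word p) (u p))"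
    and comm: "act q (D * (gen_alg GY * gen_alg GX)) = act q ((gen_alg GY * gen_alg GX) * D)"
    and "i \<noteq> j"
  shows "u (i, j) = 0"
  using \<open>i \<noteq> j\<close>
proof (induction i arbitrary: j rule: less_induct)
  case (less i)
  \<comment> \<open>The basis vector \<open>j\<close>, an eigenvector of \<open>y x\<close> with
    eigenvalue \<open>qnum q (Suc j)\<close>.\<close>
  define e :: "nat \<Rightarrow> 'k" where "e = (\<lambda>n. if n = j then 1 else 0)"
  have actD: "act q D v n = (\<Sum>p\<in>A. u p * act_word q (mono_word p) v n)" for v n
    by (simp add: D act_sum)
  have eigen: "act q (gen_alg GY * gen_alg GX) e = (\<lambda>n. qnum q (Suc j) * e n)"
    by (auto simp: fun_eq_iff act_yx e_def)
  \<comment> \<open>In \<open>D t\<close> the operator \<open>t\<close> scales the input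
    \<open>e\<close>; in \<open>t D\<close> it scales the output coordinate \<open>i\<close>. As the
    two eigenvalues differ, this matrix entry of \<open>D\<close> must vanish.\<close>
  have "qnum q (Suc j) * act q D e i = act q (D * (gen_alg GY * gen_alg GX)) e i"
    by (simp only: act_mult[of q D] eigen)
      (simp add: actD act_word_scale sum_distrib_left mult.left_commute)
  also have "\<dots> = qnum q (Suc i) * act q D e i"
    by (simp only: comm act_mult[of q _ D] act_yx)
  finally have "act q D e i = 0"
    using qnum_inject[OF q, of "Suc j" "Suc i"] less.prems by auto
  moreover have "u p * act_word q (mono_word p) e i = 0" if p: "p \<noteq> (i, j)" for p
  proof (cases p)
    case (Pair k l)
    \<comment> \<open>In order: the induction hypothesis kills the coefficient; a diagonal monomial
      reads \<open>e i\<close>, which is 0 as \<open>i \<noteq> j\<close>; the monomial reads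
      \<open>e l\<close> with \<open>l \<noteq> j\<close>; the output index lies below the
      shift.\<close>
    consider "k < i" "l \<noteq> k" | "k < i" "l = k" | "k = i" "l \<noteq> j" | "k > i"
      using p Pair by fastforce
    then show ?thesis
      using less.IH[of k l] less.prems Pair by cases (auto simp: act_mono_word e_def)
  qed
  then have "act q D e i = (\<Sum>p\<in>A. if p = (i, j) then u p * act_word q (mono_word p) e i else 0)"
    unfolding actD by (intro sum.cong) auto
  \<comment> \<open>The surviving entry is the q-factorial of \<open>j\<close>; its factors are
    nonzero by injectivity against \<open>qnum q 0 = 0\<close>.\<close>
  moreover have "act_word q (mono_word (i, j)) e i \<noteq> 0"
  proof -
    have "qnum q (Suc k) \<noteq> 0" for k
      using qnum_inject[OF q, of "Suc k" 0] by (auto simp: qnum_def)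
    then show ?thesis
      by (simp add: act_mono_word e_def)
  qed
  ultimately show ?case
    using fin supp[of "(i, j)"] by (cases "(i, j) \<in> A") (simp_all add: sum.delta)
qed

subsection \<open>Diagonal automorphisms\<close>

text \<open>The eigenvalue of the class of a word under the automorphism with parameter
  \<open>\<beta>\<close>.\<close>

definition word_weight :: "'k::field \<Rightarrow> word \<Rightarrow> 'k"
  where "word_weight \<beta> u =
    prod_list (map (\<lambda>g. case g of GX \<Rightarrow> inverse \<beta> | GY \<Rightarrow> \<beta>) (letters u))"

lemma word_weight_mono_word:
  "\<beta> \<noteq> 0 \<Longrightarrow> word_weight \<beta> (mono_word (i, j)) = \<beta> powi (int j - int i)"
  by (simp add: word_weight_def mono_word_def power_int_diff field_simps)

section \<open>Computing in the quotient through representatives\<close>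

lemma qsmult_class: "qsmult q a (qweyl_class q f) = qweyl_class q (const_alg a * f)"
  by (simp add: qsmult_def qweyl_class_mult)

lemma const_alg_single [simp]:
  "const_alg a * Poly_Mapping.single u b = Poly_Mapping.single u (a * b)"
  by (simp add: const_alg_def mult_single)

lemma qweyl_class_zero: "qweyl_class q 0 = \<zero>\<^bsub>qweyl q\<^esub>"
proof -
  interpret ring "qweyl q" by (rule ring_qweyl)
  show ?thesis
    using qweyl_class_add[of q 0 0] by simp
qed

lemma qweyl_class_diff:
  "qweyl_class q (f - g) = qweyl_class q f \<ominus>\<^bsub>qweyl q\<^esub> qweyl_class q g"
proof -
  interpret ring "qweyl q" by (rule ring_qweyl)
  have "qweyl_class q f = qweyl_class q (f - g) \<oplus>\<^bsub>qweyl q\<^esub> qweyl_class q g"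
    by (simp flip: qweyl_class_add)
  then show ?thesis
    by (simp add: a_minus_def a_assoc r_neg)
qed

lemma qweyl_class_sum:
  "finite A \<Longrightarrow> qweyl_class q (\<Sum>p\<in>A. f p) = (\<Oplus>\<^bsub>qweyl q\<^esub>p\<in>A. qweyl_class q (f p))"
proof (induction A rule: finite_induct)
  interpret ring "qweyl q" by (rule ring_qweyl)
  case empty
  then show ?case by (simp add: qweyl_class_zero)
next
  interpret ring "qweyl q" by (rule ring_qweyl)
  case (insert p A)
  then show ?case by (simp add: qweyl_class_add)
qed

lemma gen_alg_power:
  "gen_alg g ^ n = Poly_Mapping.single (Word (replicate n g)) (1 :: 'k::field)"
proof (induction n)
  case 0
  then show ?case by (simp add: zero_word_def flip: single_one)
next
  case (Suc n)
  then show ?case by (simp add: gen_alg_def mult_single plus_word_def)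
qed

lemma qweyl_class_power: "qweyl_class q f [^]\<^bsub>qweyl q\<^esub> (n::nat) = qweyl_class q (f ^ n)"
proof -
  interpret ring "qweyl q" by (rule ring_qweyl)
  show ?thesis
    by (induction n) (simp_all add: qweyl_class_one power_commutes flip: qweyl_class_mult)
qed

text \<open>Supplies a representative of \<open>w\<close> in the free algebra, where the action and
  the weights can be computed.\<close>

lemma qweyl_elem_class:
  "qweyl_elem q c = qweyl_class q (\<Sum>p\<in>Poly_Mapping.keys c.
    Poly_Mapping.single (mono_word p) (Poly_Mapping.lookup c p))"
proof -
  have "qsmult q a (qx q [^]\<^bsub>qweyl q\<^esub> i \<otimes>\<^bsub>qweyl q\<^esub> qy q [^]\<^bsub>qweyl q\<^esub> j) =
      qweyl_class q (Poly_Mapping.single (mono_word (i, j)) a)" for a and i j :: nat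
    by (simp add: qx_def qy_def qweyl_class_power gen_alg_power qsmult_class mult_single
        plus_word_def mono_word_def flip: qweyl_class_mult)
  then show ?thesis
    by (simp add: qweyl_elem_def qweyl_class_sum split_def)
qed

text \<open>Both automorphisms of the theorem are instances: \<open>\<sigma>\<close> with parameter
  \<open>\<mu>\<close> and \<open>\<rho>\<close> with parameter \<open>\<beta>\<close>.\<close>

locale diagonal_automorphism =
  fixes q \<beta> :: "'k::field" and \<rho> :: "'k free_alg set \<Rightarrow> 'k free_alg set"
  assumes aut: "qweyl_automorphism q \<rho>"
    and rho_x: "\<rho> (qx q) = qsmult q (inverse \<beta>) (qx q)"
    and rho_y: "\<rho> (qy q) = qsmult q \<beta> (qy q)"
begin

lemma hom: "\<rho> \<in> ring_hom (qweyl q) (qweyl q)"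
  using aut by (simp add: qweyl_automorphism_def ring_iso_def)

lemma rho_const: "\<rho> (qweyl_class q (const_alg a * f)) = qsmult q a (\<rho> (qweyl_class q f))"
  using aut by (simp add: qweyl_automorphism_def flip: qsmult_class)

lemma rho_mult: "\<rho> (qweyl_class q (f * g)) = \<rho> (qweyl_class q f) \<otimes>\<^bsub>qweyl q\<^esub> \<rho> (qweyl_class q g)"
  using ring_hom_mult[OF hom] by (simp add: qweyl_class_mult)

lemma rho_add: "\<rho> (qweyl_class q (f + g)) = \<rho> (qweyl_class q f) \<oplus>\<^bsub>qweyl q\<^esub> \<rho> (qweyl_class q g)"
  using ring_hom_add[OF hom] by (simp add: qweyl_class_add)

text \<open>The generators are eigenvectors and \<open>\<rho>\<close> is multiplicative, so
  eigenvalues multiply along a word; linearity brings in the coefficient.\<close>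

lemma rho_single:
  "\<rho> (qweyl_class q (Poly_Mapping.single u a)) =
    qweyl_class q (Poly_Mapping.single u (word_weight \<beta> u * a))"
proof -
  have gen: "\<rho> (qweyl_class q (gen_alg g)) =
      qweyl_class q (Poly_Mapping.single (Word [g]) (word_weight \<beta> (Word [g])))" for g
    using rho_x rho_y
    by (cases g) (simp_all add: qx_def qy_def qsmult_class gen_alg_def word_weight_def)
  have one: "\<rho> (qweyl_class q (Poly_Mapping.single (Word gs) 1)) =
      qweyl_class q (Poly_Mapping.single (Word gs) (word_weight \<beta> (Word gs)))" for gs
  proof (induction gs)
    case Nil
    have "Poly_Mapping.single (Word []) (1 :: 'k) = 1" "word_weight \<beta> (Word []) = 1"
      by (simp flip: zero_word_def, simp add: word_weight_def)
    then show ?case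
      using ring_hom_one[OF hom] by (simp add: qweyl_class_one)
  next
    case (Cons g gs)
    have split: "Poly_Mapping.single (Word (g # gs)) 1 =
        gen_alg g * Poly_Mapping.single (Word gs) (1 :: 'k)"
      by (simp add: gen_alg_def mult_single plus_word_def)
    show ?case
      unfolding split rho_mult gen Cons
      by (simp add: mult_single plus_word_def word_weight_def flip: qweyl_class_mult)
  qed
  have "Poly_Mapping.single u a = const_alg a * Poly_Mapping.single u 1"
    by simp
  then show ?thesis
    using one[of "letters u"] by (simp only: rho_const) (simp add: qsmult_class mult.commute)
qed

lemma rho_zero: "\<rho> (qweyl_class q 0) = qweyl_class q 0"
  using rho_single[of 0 0] by simp

lemma rho_sum:
  "finite A \<Longrightarrow> \<rho> (qweyl_class q (\<Sum>p\<in>A. Poly_Mapping.single (u p) (a p))) =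
    qweyl_class q (\<Sum>p\<in>A. Poly_Mapping.single (u p) (word_weight \<beta> (u p) * a p))"
  by (induction A rule: finite_induct)
    (simp_all add: rho_zero rho_add rho_single flip: qweyl_class_add)

lemma rho_diff:
  assumes "r \<in> carrier (qweyl q)" "s \<in> carrier (qweyl q)"
  shows "\<rho> (r \<ominus>\<^bsub>qweyl q\<^esub> s) = \<rho> r \<ominus>\<^bsub>qweyl q\<^esub> \<rho> s"
proof -
  interpret ring_hom_ring "qweyl q" "qweyl q" \<rho>
    by (rule ring_hom_ringI2[OF ring_qweyl ring_qweyl hom])
  show ?thesis
    using assms by (simp add: a_minus_def)
qed

lemma rho_yx:
  "\<beta> \<noteq> 0 \<Longrightarrow> \<rho> (qweyl_class q (gen_alg GY * gen_alg GX)) = qweyl_class q (gen_alg GY * gen_alg GX)"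
  by (simp add: gen_alg_def mult_single rho_single word_weight_def plus_word_def)

end

lemma diagonal_automorphisms_commute:
  assumes "diagonal_automorphism q \<beta> \<rho>" "diagonal_automorphism q \<mu> \<sigma>"
    and "r \<in> carrier (qweyl q)"
  shows "\<rho> (\<sigma> r) = \<sigma> (\<rho> r)"
proof -
  interpret \<rho>: diagonal_automorphism q \<beta> \<rho> by fact
  interpret \<sigma>: diagonal_automorphism q \<mu> \<sigma> by fact
  have "\<rho> (\<sigma> (qweyl_class q f)) = \<sigma> (\<rho> (qweyl_class q f))" for f
  proof (induction f rule: free_alg_induct)
    case (single u a)
    then show ?case by (simp add: \<rho>.rho_single \<sigma>.rho_single mult.left_commute)
  next
    case (add f g)
    have "\<rho> (qweyl_class q h) \<in> carrier (qweyl q)" "\<sigma> (qweyl_class q h) \<in> carrier (qweyl q)" for h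
      using ring_hom_closed[OF \<rho>.hom] ring_hom_closed[OF \<sigma>.hom] by simp_all
    then show ?case
      using add ring_hom_add[OF \<rho>.hom] ring_hom_add[OF \<sigma>.hom]
      by (simp add: \<rho>.rho_add \<sigma>.rho_add)
  qed
  then show ?thesis
    using assms(3) by (auto simp: carrier_qweyl)
qed

text \<open>The exponents \<open>s\<close> with \<open>\<beta> powi s = 1\<close> form a subgroup of
  the integers. It is closed under multiples, which gives one direction, and under Bezout
  combinations, which gives the other by induction on \<open>S\<close>. For empty \<open>S\<close>
  the gcd is 0 and the power is 1.\<close>

lemma power_int_Gcd_eq_1_iff:
  fixes \<beta> :: "'k::field"
  assumes "\<beta> \<noteq> 0" "finite S"
  shows "\<beta> powi (Gcd S) = 1 \<longleftrightarrow> (\<forall>s\<in>S. \<beta> powi s = 1)"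
proof
  assume "\<beta> powi (Gcd S) = 1"
  then show "\<forall>s\<in>S. \<beta> powi s = 1"
    by (metis Gcd_dvd dvdE power_int_mult power_int_1_left)
next
  assume "\<forall>s\<in>S. \<beta> powi s = 1"
  with \<open>finite S\<close> show "\<beta> powi (Gcd S) = 1"
  proof (induction S rule: finite_induct)
    case empty
    then show ?case by simp
  next
    case (insert s S)
    obtain a b where "a * s + b * Gcd S = Gcd (insert s S)"
      using bezout_int[of s "Gcd S"] by auto
    moreover have "\<beta> powi (a * s + b * Gcd S) = (\<beta> powi s) powi a * (\<beta> powi Gcd S) powi b"
      using \<open>\<beta> \<noteq> 0\<close> by (simp add: power_int_add mult.commute flip: power_int_mult)
    ultimately show ?case
      using insert by simp
  qed
qed

theorem theorem8:
  fixes q \<mu> \<beta> :: "'k :: {alg_closed_field, field_char_0}"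
    and \<sigma> \<rho> \<delta> :: "'k free_alg set \<Rightarrow> 'k free_alg set"
    and w :: "'k free_alg set"
    and c :: "nat \<times> nat \<Rightarrow>\<^sub>0 'k"
    and S :: "int set"
  assumes "q \<noteq> 0"
    and "\<And>n::nat. n > 0 \<Longrightarrow> q ^ n \<noteq> 1"
    and "\<mu> \<noteq> 0"
    and "qweyl_automorphism q \<sigma>"
    and "\<sigma> (qx q) = qsmult q (inverse \<mu>) (qx q)"
    and "\<sigma> (qy q) = qsmult q \<mu> (qy q)"
    and "w = qweyl_elem q c"
    and "S = {int j - int i | i j. Poly_Mapping.lookup c (i, j) \<noteq> 0}"
    and "\<delta> = inner_sderiv q \<sigma> w"
    and "\<beta> \<noteq> 0"
    and "qweyl_automorphism q \<rho>"
    and "\<exists>r\<in>carrier (qweyl q). \<rho> r \<noteq> r"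
    and "\<rho> (qx q) = qsmult q (inverse \<beta>) (qx q)"
    and "\<rho> (qy q) = qsmult q \<beta> (qy q)"
  shows "(\<forall>r\<in>carrier (qweyl q). \<delta> (\<rho> r) = \<rho> (\<delta> r)) \<longleftrightarrow> \<beta> powi (Gcd S) = 1"
proof -
  interpret R: ring "qweyl q" by (rule ring_qweyl)
  interpret \<sigma>: diagonal_automorphism q \<mu> \<sigma>
    by unfold_locales (fact assms)+
  interpret \<rho>: diagonal_automorphism q \<beta> \<rho>
    by unfold_locales (fact assms)+
  let ?K = "Poly_Mapping.keys c" and ?c = "Poly_Mapping.lookup c"
  let ?b = "\<lambda>p. word_weight \<beta> (mono_word p)"
  let ?t = "gen_alg GY * gen_alg GX :: 'k free_alg"
  define W where "W = (\<Sum>p\<in>?K. Poly_Mapping.single (mono_word p) (?c p))"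
  define W' where "W' = (\<Sum>p\<in>?K. Poly_Mapping.single (mono_word p) (?b p * ?c p))"
  have w: "w = qweyl_class q W"
    using assms(7) by (simp add: W_def qweyl_elem_class)
  have rho_w: "\<rho> w = qweyl_class q W'"
    by (simp add: w W_def W'_def \<rho>.rho_sum)
  have S: "S = (\<lambda>(i, j). int j - int i) ` ?K"
    unfolding assms(8) by (force simp: in_keys_iff)
  \<comment> \<open>The weight of the monomial \<open>(i, j)\<close> is
    \<open>\<beta> powi (j - i)\<close>, so the gcd condition says that every monomial of
    \<open>w\<close> is fixed by \<open>\<rho>\<close>.\<close>
  have S_iff: "\<beta> powi (Gcd S) = 1 \<longleftrightarrow> (\<forall>p\<in>?K. ?b p = 1)"
    using power_int_Gcd_eq_1_iff[OF \<open>\<beta> \<noteq> 0\<close>, of S] \<open>\<beta> \<noteq> 0\<close>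
    by (auto simp: S word_weight_mono_word)
  have rho_delta: "\<rho> (\<delta> r) = \<rho> w \<otimes>\<^bsub>qweyl q\<^esub> \<rho> r \<ominus>\<^bsub>qweyl q\<^esub> \<rho> (\<sigma> r) \<otimes>\<^bsub>qweyl q\<^esub> \<rho> w"
    if r: "r \<in> carrier (qweyl q)" for r
  proof -
    have "w \<in> carrier (qweyl q)" "\<sigma> r \<in> carrier (qweyl q)"
      using r ring_hom_closed[OF \<sigma>.hom] by (simp_all add: w)
    then show ?thesis
      using r by (simp add: assms(9) inner_sderiv_def \<rho>.rho_diff ring_hom_mult[OF \<rho>.hom])
  qed
  show ?thesis
  proof
    assume comm: "\<forall>r\<in>carrier (qweyl q). \<delta> (\<rho> r) = \<rho> (\<delta> r)"
    have "\<delta> (\<rho> (qweyl_class q ?t)) = \<rho> (\<delta> (qweyl_class q ?t))"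
      using comm by simp
    \<comment> \<open>Both \<open>\<sigma>\<close> and \<open>\<rho>\<close> fix \<open>t\<close>,
      so the two composites at \<open>t\<close> are the commutators of \<open>w\<close> and of
      \<open>\<rho> w\<close> with \<open>t\<close>.\<close>
    then have "qweyl_class q (W * ?t - ?t * W) = qweyl_class q (W' * ?t - ?t * W')"
      by (simp only: rho_delta qweyl_class_closed \<sigma>.rho_yx[OF \<open>\<mu> \<noteq> 0\<close>]
          \<rho>.rho_yx[OF \<open>\<beta> \<noteq> 0\<close>] rho_w)
        (simp only: assms(9) inner_sderiv_def w qweyl_class_diff qweyl_class_mult
          \<sigma>.rho_yx[OF \<open>\<mu> \<noteq> 0\<close>, unfolded qweyl_class_mult])
    then have "act q (W * ?t - ?t * W) = act q (W' * ?t - ?t * W')"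
      by (rule act_eq_if_class_eq)
    then have "act q ((W - W') * ?t) v n = act q (?t * (W - W')) v n" for v n
      by (simp add: fun_eq_iff act_diff left_diff_distrib right_diff_distrib diff_eq_eq)
    then have D_comm: "act q ((W - W') * ?t) = act q (?t * (W - W'))"
      by (simp add: fun_eq_iff)
    have D: "W - W' = (\<Sum>p\<in>?K. Poly_Mapping.single (mono_word p) (?c p - ?b p * ?c p))"
      by (simp add: W_def W'_def sum_subtractf single_diff)
    have "?b (i, j) = 1" if "(i, j) \<in> ?K" for i j
    proof (cases "i = j")
      case True
      then show ?thesis using \<open>\<beta> \<noteq> 0\<close> by (simp add: word_weight_mono_word)
    next
      case False
      \<comment> \<open>The coefficient of \<open>w - \<rho> w\<close> at \<open>(i, j)\<close>. As
        \<open>?c (i, j)\<close> is nonzero on the support, its vanishing forces the weight to be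
        1.\<close>
      have "?c (i, j) - ?b (i, j) * ?c (i, j) = 0"
        by (rule off_diagonal_coeff_eq_0[OF assms(1,2) _ _ D D_comm False])
          (simp_all add: in_keys_iff)
      then show ?thesis
        using that by (simp add: in_keys_iff)
    qed
    then show "\<beta> powi (Gcd S) = 1"
      by (auto simp: S_iff)
  next
    assume "\<beta> powi (Gcd S) = 1"
    then have "W' = W"
      by (simp add: W_def W'_def S_iff)
    then have "\<rho> w = w"
      using rho_w w by simp
    \<comment> \<open>With \<open>\<rho> w = w\<close>, the two composites differ only in the order
      of \<open>\<rho>\<close> and \<open>\<sigma>\<close> applied to \<open>r\<close>.\<close>
    then show "\<forall>r\<in>carrier (qweyl q). \<delta> (\<rho> r) = \<rho> (\<delta> r)"
      using diagonal_automorphisms_commute[OF \<rho>.diagonal_automorphism_axioms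
          \<sigma>.diagonal_automorphism_axioms]
      by (intro ballI, simp only: rho_delta) (simp add: assms(9) inner_sderiv_def)
  qed
qed

end
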